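(* Let $N$ be a positive integer, $n\in\{2,\ldots,N\}$, and $\beta:=\left(1-\frac1N\right)^n\in(0,1)$. Then the Clopper-Pearson upray $K_{\mathrm{CP},n}=K_{\mathrm{CP},n,\beta}$ is not a $\beta$-confidence region for the hypergeometric estimation problem $\left(\left(\mathrm H_{n,p,N} : p\in\{\tfrac jN : j\in\{0,\ldots,N\}\}\right),\ p\mapsto p\right)$; namely, for $p=g_{n}(1)=1-\beta^{1/n}=\frac1N$, $$\mathrm H_{n,p,N}\big(\{x\in\{0,\ldots,n\} : p\in K_{\mathrm{CP},n}(x)\}\big)<\beta .$$
   Context: For $n\in\{0,\ldots,N\}$ and $p\in\{\frac jN : j\in\{0,\ldots,N\}\}$, $\mathrm H_{n,p,N}$ is the hypergeometric law of the number of red balls in a simple random sample (without replacement) of size $n$ from an urn containing $Np$ red and $N(1-p)$ blue balls, i.e. $\mathrm H_{n,p,N}(\{k\})=\binom{Np}{k}\binom{N(1-p)}{n-k}/\binom Nn$. A function $K\colon\{0,\ldots,n\}\to 2^{[0,1]}$ is a $\beta$-confidence region for the hypergeometric estimation problem if $\mathrm H_{n,p,N}(\{x : p\in K(x)\})\ge\beta$ for all $p\in\{\frac jN : j\in\{0,\ldots,N\}\}$. $\mathrm{B}_{n,p}$ is the binomial law. For $\beta\in(0,1)$ and $x\in\{1,\ldots,n\}$, $g_n(x)=g_{n,\beta}(x)$ denotes the unique $p\in[0,1]$ with $\mathrm{B}_{n,p}(\{x,\ldots,n\})=1-\beta$. The Clopper-Pearson upray is $K_{\mathrm{CP},n}(0):=[0,1]$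 and $K_{\mathrm{CP},n}(x):=(g_n(x),1]$ for $x\in\{1,\ldots,n\}$. *)

theory Defs
  imports "HOL-Probability.Probability"
begin

definition success_grid :: "nat \<Rightarrow> real set" where
  "success_grid N = {real j / real N |j. j \<le> N}"

text \<open>
  The urn is \<open>{..<N}\<close>, and its red balls are those below \<open>N p\<close>. The floor only converts
  the type: \<open>N p\<close> is an integer for \<open>p\<close> in the grid. The closed form of the mass function is
  lemma \<open>pmf_hypergeometric\<close> below.
\<close>

definition hypergeometric_pmf :: "nat \<Rightarrow> real \<Rightarrow> nat \<Rightarrow> nat pmf" where
  "hypergeometric_pmf n p N =
     map_pmf (\<lambda>S. card (S \<inter> {..<nat \<lfloor>real N * p\<rfloor>}))
       (pmf_of_set {S. S \<subseteq> {..<N} \<and> card S = n})"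

definition hypergeometric_confidence_region ::
    "real \<Rightarrow> nat \<Rightarrow> nat \<Rightarrow> (nat \<Rightarrow> real set) \<Rightarrow> bool" where
  "hypergeometric_confidence_region \<beta> n N K \<longleftrightarrow>
     (\<forall>x\<in>{0..n}. K x \<subseteq> {0..1}) \<and>
     (\<forall>p\<in>success_grid N.
        measure_pmf.prob (hypergeometric_pmf n p N) {x\<in>{0..n}. p \<in> K x} \<ge> \<beta>)"

text \<open>
  For \<open>0 < \<beta> < 1\<close> and \<open>1 \<le> x \<le> n\<close> the description is proper, see lemma \<open>cp_bound_ex1\<close>.
\<close>

definition cp_bound :: "nat \<Rightarrow> real \<Rightarrow> nat \<Rightarrow> real" where
  "cp_bound n \<beta> x =
     (THE p. p \<in> {0..1} \<and> measure_pmf.prob (binomial_pmf n p) {x..n} = 1 - \<beta>)"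

definition cp_upray :: "nat \<Rightarrow> real \<Rightarrow> nat \<Rightarrow> real set" where
  "cp_upray n \<beta> x = (if x = 0 then {0..1} else {cp_bound n \<beta> x<..1})"


lemma card_samples_with_red:
  assumes "R \<le> N" "k \<le> n"
  shows "card {S. S \<subseteq> {..<N} \<and> card S = n \<and> card (S \<inter> {..<R}) = k}
           = (R choose k) * ((N - R) choose (n - k))"
proof -
  let ?A = "{S. S \<subseteq> {..<N} \<and> card S = n \<and> card (S \<inter> {..<R}) = k}"
  let ?B = "{A. A \<subseteq> {..<R} \<and> card A = k}"
  let ?C = "{A. A \<subseteq> {R..<N} \<and> card A = n - k}"
  have "bij_betw (\<lambda>S. (S \<inter> {..<R}, S \<inter> {R..<N})) ?A (?B \<times> ?C)"
  proof (rule bij_betwI[where g = "\<lambda>(A, B). A \<union> B"])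
    show "(\<lambda>S. (S \<inter> {..<R}, S \<inter> {R..<N})) \<in> ?A \<rightarrow> ?B \<times> ?C"
    proof
      fix S assume S: "S \<in> ?A"
      then have fin: "finite S" by (auto intro: finite_subset)
      have "S = (S \<inter> {..<R}) \<union> (S \<inter> {R..<N})" using S by auto
      then have "card S = card (S \<inter> {..<R}) + card (S \<inter> {R..<N})"
        using fin by (metis card_Un_disjoint finite_Int Int_assoc Int_left_commute
            ivl_disj_int_one(2) inf_bot_right)
      then show "(S \<inter> {..<R}, S \<inter> {R..<N}) \<in> ?B \<times> ?C" using S by auto
    qed
    show "(\<lambda>(A, B). A \<union> B) \<in> ?B \<times> ?C \<rightarrow> ?A"
    proof (clarify, intro conjI)
      fix A B assume A: "A \<subseteq> {..<R}" "k = card A" and B: "B \<subseteq> {R..<N}" "card B = n - card A"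
      then have fin: "finite A" "finite B" by (auto intro: finite_subset)
      have disj: "A \<inter> B = {}" using A B by fastforce
      show "A \<union> B \<subseteq> {..<N}" using A B assms(1) by fastforce
      show "card (A \<union> B) = n" using fin disj A B assms(2) by (simp add: card_Un_disjoint)
      have "(A \<union> B) \<inter> {..<R} = A" using A B by fastforce
      then show "card ((A \<union> B) \<inter> {..<R}) = card A" by simp
    qed
  next
    fix S assume "S \<in> ?A"
    then show "(case (S \<inter> {..<R}, S \<inter> {R..<N}) of (A, B) \<Rightarrow> A \<union> B) = S" by auto
  next
    fix y assume "y \<in> ?B \<times> ?C"
    then show "((case y of (A, B) \<Rightarrow> A \<union> B) \<inter> {..<R}, (case y of (A, B) \<Rightarrow> A \<union> B) \<inter> {R..<N}) = y"
      by fastforce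
  qed
  then have "card ?A = card ?B * card ?C"
    by (simp add: bij_betw_same_card card_cartesian_product)
  also have "\<dots> = (R choose k) * ((N - R) choose (n - k))"
    using n_subsets[of "{..<R}" k] n_subsets[of "{R..<N}" "n - k"] by simp
  finally show ?thesis .
qed

lemma pmf_hypergeometric:
  assumes "n \<le> N" "j \<le> N" "0 < N" "k \<le> n"
  shows "pmf (hypergeometric_pmf n (real j / real N) N) k
           = real (j choose k) * real ((N - j) choose (n - k)) / real (N choose n)"
proof -
  let ?U = "{S. S \<subseteq> {..<N} \<and> card S = n}"
  have fin: "finite ?U" by simp
  have card: "card ?U = N choose n" using n_subsets[of "{..<N}" n] by simp
  then have ne: "?U \<noteq> {}" using assms(1) by (metis card.empty zero_less_binomial less_irrefl)
  have R: "nat \<lfloor>real N * (real j / real N)\<rfloor> = j" using assms(3) by simp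
  have "pmf (hypergeometric_pmf n (real j / real N) N) k
          = measure_pmf.prob (pmf_of_set ?U) ((\<lambda>S. card (S \<inter> {..<j})) -` {k})"
    unfolding hypergeometric_pmf_def R by (simp add: pmf_map)
  also have "\<dots> = real (card (?U \<inter> (\<lambda>S. card (S \<inter> {..<j})) -` {k})) / real (N choose n)"
    using measure_pmf_of_set[OF ne fin] card by simp
  also have "?U \<inter> (\<lambda>S. card (S \<inter> {..<j})) -` {k}
               = {S. S \<subseteq> {..<N} \<and> card S = n \<and> card (S \<inter> {..<j}) = k}" by auto
  finally show ?thesis using card_samples_with_red[OF assms(2,4)] by simp
qed


definition binomial_tail :: "nat \<Rightarrow> nat \<Rightarrow> real \<Rightarrow> real" where
  "binomial_tail n x p = (\<Sum>k=x..n. real (n choose k) * p ^ k * (1 - p) ^ (n - k))"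

lemma binomial_tail_eq:
  assumes "p \<in> {0..1}"
  shows "measure_pmf.prob (binomial_pmf n p) {x..n} = binomial_tail n x p"
  using assms by (simp add: binomial_tail_def measure_measure_pmf_finite)

lemma binomial_tail_rec:
  assumes "x \<le> n"
  shows "binomial_tail n x p
           = real (n choose x) * p ^ x * (1 - p) ^ (n - x) + binomial_tail n (Suc x) p"
  using assms by (simp add: binomial_tail_def sum.atLeast_Suc_atMost)

lemma binomial_tail_0: "binomial_tail n 0 p = 1"
  using binomial_ring[of p "1 - p" n] by (simp add: binomial_tail_def atLeast0AtMost)

lemma binomial_tail_Suc:
  "binomial_tail (Suc n) (Suc x) p = p * binomial_tail n x p + (1 - p) * binomial_tail n (Suc x) p"
proof -
  have "binomial_tail (Suc n) (Suc x) p
      = (\<Sum>k=x..n. real (n choose k) * p ^ Suc k * (1 - p) ^ (n - k))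
        + (\<Sum>k=x..n. real (n choose Suc k) * p ^ Suc k * (1 - p) ^ (n - k))"
    by (simp add: binomial_tail_def sum.atLeast_Suc_atMost_Suc_shift sum.distrib algebra_simps
             del: sum.cl_ivl_Suc)
  moreover have "(\<Sum>k=x..n. real (n choose Suc k) * p ^ Suc k * (1 - p) ^ (n - k))
      = (1 - p) * binomial_tail n (Suc x) p"
  proof -
    have "(\<Sum>k=x..n. real (n choose Suc k) * p ^ Suc k * (1 - p) ^ (n - k))
        = (\<Sum>k=Suc x..Suc n. real (n choose k) * p ^ k * (1 - p) ^ (Suc n - k))"
      by (simp only: sum.atLeast_Suc_atMost_Suc_shift o_def diff_Suc_Suc)
    also have "\<dots> = (\<Sum>k=Suc x..n. real (n choose k) * p ^ k * (1 - p) ^ (Suc n - k))"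
      by (rule sum.mono_neutral_right) auto
    also have "\<dots> = (\<Sum>k=Suc x..n. (1 - p) * (real (n choose k) * p ^ k * (1 - p) ^ (n - k)))"
      by (intro sum.cong) (auto simp: Suc_diff_le)
    finally show ?thesis by (simp add: binomial_tail_def sum_distrib_left)
  qed
  moreover have "(\<Sum>k=x..n. real (n choose k) * p ^ Suc k * (1 - p) ^ (n - k))
      = p * binomial_tail n x p"
    by (simp add: binomial_tail_def sum_distrib_left mult_ac)
  ultimately show ?thesis by simp
qed

lemma binomial_tail_mono:
  assumes "0 \<le> p" "p \<le> q" "q \<le> 1"
  shows "binomial_tail n x p \<le> binomial_tail n x q"
proof (induction n arbitrary: x)
  case 0
  show ?case by (cases x) (auto simp: binomial_tail_def)
next
  case (Suc n)
  show ?case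
  proof (cases x)
    case 0
    then show ?thesis by (simp add: binomial_tail_0)
  next
    case [simp]: (Suc y)
    have dec: "binomial_tail n (Suc y) q \<le> binomial_tail n y q"
      unfolding binomial_tail_def using assms by (intro sum_mono2) auto
    have "p * binomial_tail n y p + (1 - p) * binomial_tail n (Suc y) p
        \<le> p * binomial_tail n y q + (1 - p) * binomial_tail n (Suc y) q"
      using assms Suc.IH by (intro add_mono mult_left_mono) auto
    also have "\<dots> = p * (binomial_tail n y q - binomial_tail n (Suc y) q) + binomial_tail n (Suc y) q"
      by (simp add: algebra_simps)
    also have "\<dots> \<le> q * (binomial_tail n y q - binomial_tail n (Suc y) q) + binomial_tail n (Suc y) q"
      using assms dec by (intro add_right_mono mult_right_mono) auto
    also have "\<dots> = q * binomial_tail n y q + (1 - q) * binomial_tail n (Suc y) q"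
      by (simp add: algebra_simps)
    finally show ?thesis by (simp add: binomial_tail_Suc)
  qed
qed

lemma binomial_tail_strict_mono:
  assumes "0 \<le> p" "p < q" "q < 1" "1 \<le> x" "x \<le> n"
  shows "binomial_tail n x p < binomial_tail n x q"
proof -
  obtain m y where [simp]: "n = Suc m" "x = Suc y" and "y \<le> m"
    using assms by (metis Suc_le_D One_nat_def Suc_le_mono)
  have dec: "binomial_tail m (Suc y) q < binomial_tail m y q"
    using binomial_tail_rec[OF \<open>y \<le> m\<close>, of q] assms \<open>y \<le> m\<close> by simp
  have "p * binomial_tail m y p + (1 - p) * binomial_tail m (Suc y) p
      \<le> p * binomial_tail m y q + (1 - p) * binomial_tail m (Suc y) q"
    using assms by (intro add_mono mult_left_mono binomial_tail_mono) auto
  also have "\<dots> = p * (binomial_tail m y q - binomial_tail m (Suc y) q) + binomial_tail m (Suc y) q"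
    by (simp add: algebra_simps)
  also have "\<dots> < q * (binomial_tail m y q - binomial_tail m (Suc y) q) + binomial_tail m (Suc y) q"
    using assms dec by (intro add_strict_right_mono mult_strict_right_mono) auto
  also have "\<dots> = q * binomial_tail m y q + (1 - q) * binomial_tail m (Suc y) q"
    by (simp add: algebra_simps)
  finally show ?thesis by (simp add: binomial_tail_Suc)
qed

lemma cp_bound_ex1:
  assumes "0 < \<beta>" "\<beta> < 1" "1 \<le> x" "x \<le> n"
  shows "\<exists>!p. p \<in> {0..1} \<and> measure_pmf.prob (binomial_pmf n p) {x..n} = 1 - \<beta>"
proof -
  have t0: "binomial_tail n x 0 = 0"
    unfolding binomial_tail_def using assms by (intro sum.neutral) auto
  have t1: "binomial_tail n x 1 = 1"
  proof -
    have "binomial_tail n x 1 = (\<Sum>k\<in>{n}. real (n choose k) * 1 ^ k * (1 - 1) ^ (n - k))"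
      unfolding binomial_tail_def using assms by (intro sum.mono_neutral_right) auto
    then show ?thesis by simp
  qed
  have "continuous_on {0..1} (binomial_tail n x)"
    unfolding binomial_tail_def by (intro continuous_intros)
  then obtain p where p: "0 \<le> p" "p \<le> 1" "binomial_tail n x p = 1 - \<beta>"
    using IVT'[of "binomial_tail n x" 0 "1 - \<beta>" 1] assms t0 t1 by auto
  have uniq: "\<not> a < b" if "a \<in> {0..1}" "b \<in> {0..1}"
      "binomial_tail n x a = 1 - \<beta>" "binomial_tail n x b = 1 - \<beta>" for a b
  proof
    assume "a < b"
    moreover have "b \<noteq> 1" using that t1 assms by auto
    ultimately show False using binomial_tail_strict_mono[of a b x n] that assms by auto
  qed
  show ?thesis
  proof (rule ex1I[of _ p])
    show "p \<in> {0..1} \<and> measure_pmf.prob (binomial_pmf n p) {x..n} = 1 - \<beta>"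
      using p by (simp add: binomial_tail_eq)
  next
    fix q assume "q \<in> {0..1} \<and> measure_pmf.prob (binomial_pmf n q) {x..n} = 1 - \<beta>"
    then show "q = p" using uniq[of p q] uniq[of q p] p binomial_tail_eq[of q n x] by force
  qed
qed

lemma cp_upray_subset:
  assumes "0 < \<beta>" "\<beta> < 1" "x \<le> n"
  shows "cp_upray n \<beta> x \<subseteq> {0..1}"
proof (cases "x = 0")
  case False
  then have "cp_bound n \<beta> x \<in> {0..1}"
    using theI'[OF cp_bound_ex1[of \<beta> x n]] assms unfolding cp_bound_def by auto
  then show ?thesis using False by (auto simp: cp_upray_def)
qed (simp add: cp_upray_def)

end

theory Submission
  imports Defs
begin

text \<open>
  The case \<open>p = 1 / N\<close> is the urn with a single red ball. A sample then contains zero or one red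
  ball, and because the upray is open at its lower bound, the observation \<open>1\<close> leaves out
  \<open>p = g\<^sub>n(1)\<close>. Coverage at \<open>p\<close> is therefore the probability \<open>1 - n / N\<close> of missing the red ball
  (\<open>coverage_one_red\<close>). Sampling with replacement would miss it with probability
  \<open>(1 - 1 / N)^n = \<beta>\<close>, which is strictly larger by Bernoulli's inequality: draws without
  replacement find a red ball more readily. The value of \<open>g\<^sub>n(1)\<close> comes from the complementary
  event of no success (\<open>cp_bound_one\<close>), so \<open>\<beta>\<close> is chosen exactly to put \<open>g\<^sub>n(1)\<close> on the grid.
\<close>

lemma cp_bound_one:
  assumes "0 < q" "q < 1" "1 \<le> n"
  shows "cp_bound n ((1 - q) ^ n) 1 = q"
  unfolding cp_bound_def
proof (rule the1_equality[OF cp_bound_ex1])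
  show "0 < (1 - q) ^ n" "(1 - q) ^ n < 1"
    using assms power_Suc_less_one[of "1 - q" "n - 1"] by simp_all
  have "binomial_tail n 1 q = 1 - (1 - q) ^ n"
    using binomial_tail_rec[of 0 n q] by (simp add: binomial_tail_0)
  then show "q \<in> {0..1} \<and> measure_pmf.prob (binomial_pmf n q) {1..n} = 1 - (1 - q) ^ n"
    using assms binomial_tail_eq[of q n 1] by simp
qed (use assms in auto)

lemma pmf_hypergeometric_one_red_0:
  assumes "0 < N" "n \<le> N"
  shows "pmf (hypergeometric_pmf n (1 / real N) N) 0 = 1 - real n / real N"
proof -
  have pos: "0 < real (N choose n)"
    using assms by simp
  have "real (N - n) * real (N choose n) = real N * real ((N - 1) choose n)"
    unfolding of_nat_mult[symmetric] by (simp only: binomial_absorb_comp)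
  then have "real ((N - 1) choose n) / real (N choose n) = real (N - n) / real N"
    using assms pos by (simp add: field_simps)
  also have "\<dots> = 1 - real n / real N"
    using assms by (simp add: of_nat_diff diff_divide_distrib)
  finally show ?thesis
    using pmf_hypergeometric[of n N 1 0] assms by simp
qed

lemma coverage_one_red:
  assumes "0 < N" "n \<le> N" "1 / real N \<in> K 0" "1 / real N \<notin> K 1"
  shows "measure_pmf.prob (hypergeometric_pmf n (1 / real N) N) {x\<in>{0..n}. 1 / real N \<in> K x}
           = 1 - real n / real N"
proof -
  let ?H = "hypergeometric_pmf n (1 / real N) N"
  have zero: "pmf ?H k = 0" if "k \<in> {x\<in>{0..n}. 1 / real N \<in> K x} - {0}" for k
  proof -
    \<comment> \<open>\<open>k\<close> is neither \<open>0\<close> nor \<open>1\<close>, so more red balls are asked for than the urn holds.\<close>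
    have "k \<noteq> 0" "k \<noteq> 1" "k \<le> n"
      using that assms(4) by auto
    then have "1 < k"
      by simp
    then show ?thesis
      using pmf_hypergeometric[of n N 1 k] assms \<open>k \<le> n\<close> by (simp add: binomial_eq_0)
  qed
  have "measure_pmf.prob ?H {x\<in>{0..n}. 1 / real N \<in> K x}
          = (\<Sum>k\<in>{x\<in>{0..n}. 1 / real N \<in> K x}. pmf ?H k)"
    by (rule measure_measure_pmf_finite) simp
  also have "\<dots> = (\<Sum>k\<in>{0}. pmf ?H k)"
    using assms(3) zero by (intro sum.mono_neutral_right) auto
  finally show ?thesis
    using pmf_hypergeometric_one_red_0[OF assms(1,2)] by simp
qed

text \<open>
  Splitting off one factor before applying the weak inequality leaves the surplus
  \<open>(n - 1) h\<^sup>2\<close>, which makes the estimate strict.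
\<close>

lemma Bernoulli_inequality_strict:
  fixes h :: real
  assumes "0 < h" "h \<le> 1" "2 \<le> n"
  shows "1 - real n * h < (1 - h) ^ n"
proof -
  obtain m where n: "n = Suc m" and m: "1 \<le> m"
    using assms(3) by (cases n) auto
  have "1 - real n * h < 1 - real n * h + real m * h\<^sup>2"
    using assms(1) m by simp
  also have "\<dots> = (1 - h) * (1 - real m * h)"
    unfolding n by (simp add: algebra_simps power2_eq_square)
  also have "\<dots> \<le> (1 - h) * (1 - h) ^ m"
    using Bernoulli_inequality[of "- h" m] assms by (intro mult_left_mono) auto
  finally show ?thesis
    by (simp add: n)
qed

theorem mainTheorem5:
  fixes N n :: nat and \<beta> p :: real
  assumes "0 < N"
    and "n \<in> {2..N}"
    and "\<beta> = (1 - 1 / real N) ^ n"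
    and "p = cp_bound n \<beta> 1"
  shows "\<beta> \<in> {0<..<1}
    \<and> \<not> hypergeometric_confidence_region \<beta> n N (cp_upray n \<beta>)
    \<and> p = 1 - \<beta> powr (1 / real n)
    \<and> p = 1 / real N
    \<and> measure_pmf.prob (hypergeometric_pmf n p N) {x\<in>{0..n}. p \<in> cp_upray n \<beta> x} < \<beta>"
proof -
  have n: "2 \<le> n" "n \<le> N"
    using assms(2) by auto
  have q: "0 < 1 / real N" "1 / real N < 1"
    using n by auto
  have p: "p = 1 / real N"
    using cp_bound_one[OF q, of n] assms(3,4) n by simp
  have beta: "0 < \<beta>" "\<beta> < 1"
    using q n power_Suc_less_one[of "1 - 1 / real N" "n - 1"] by (simp_all add: assms(3))
  have "\<beta> powr (1 / real n) = 1 - 1 / real N"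
    using q n by (simp add: assms(3) powr_realpow[symmetric] powr_powr)
  then have root: "p = 1 - \<beta> powr (1 / real n)"
    using p by simp
  have "p \<in> cp_upray n \<beta> 0" "p \<notin> cp_upray n \<beta> 1"
    using q p assms(4) by (simp add: cp_upray_def, simp add: cp_upray_def)
  then have "measure_pmf.prob (hypergeometric_pmf n p N) {x\<in>{0..n}. p \<in> cp_upray n \<beta> x}
               = 1 - real n * (1 / real N)"
    using coverage_one_red[of N n "cp_upray n \<beta>"] assms(1) n unfolding p by simp
  also have "\<dots> < \<beta>"
    unfolding assms(3) using q n by (intro Bernoulli_inequality_strict) auto
  finally have less:
    "measure_pmf.prob (hypergeometric_pmf n p N) {x\<in>{0..n}. p \<in> cp_upray n \<beta> x} < \<beta>" .
  have "p \<in> success_grid N"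
    unfolding success_grid_def p using assms(1) by (auto intro!: exI[of _ 1])
  then have "\<not> hypergeometric_confidence_region \<beta> n N (cp_upray n \<beta>)"
    unfolding hypergeometric_confidence_region_def using less by force
  then show ?thesis
    using beta root p less by simp
qed

end
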